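(* Let $\mathbf{x}=(x_1,\dots,x_T)\in\mathbb{R}^T$ be a time series, let $Q\in\mathbb{N}$ be a bin count and let $K\in\mathbb{N}$ with $K\mid T$. Let $f:\mathbb{R}\to\mathbb{R}$ be strictly increasing. Then the Temporal Markov Transition Field (with parameters $Q$ and $K$) of the transformed series $(f(x_1),\dots,f(x_T))$ equals the Temporal Markov Transition Field (with the same $Q$ and $K$) of $\mathbf{x}$.
   Context: Quantile states. Given $\mathbf{x}=(x_1,\dots,x_T)\in\mathbb{R}^T$ and a bin count $Q\in\mathbb{N}$, let $q_0<q_1<\cdots<q_Q$ be the empirical quantile boundaries of $\mathbf{x}$ such that each interval $[q_{k-1},q_k)$ contains $\lfloor T/Q\rfloor$ observations (with boundary adjustments for divisibility). The state of $x_t$ is $b_t=k$ if $x_t\in[q_{k-1},q_k)$, $k=1,\dots,Q$. The sequence $\mathbf{b}=(b_1,\dots,b_T)$ is the state sequence; the binning operates on the relative ordering (rank structure) of the observations rather than on their absolute values, and any boundary adjustment is understood as a fixed rule of this kind. Chunks. For $K\in\mathbb{N}$ with $K\mid T$, the $k$-th temporal chunk is $C_k=\{t\in\mathbb{N}:(k-1)\tfrac{T}{K}<t\le k\tfrac{T}{K}\}$, $k=1,\dots,K$. The chunk function $\mathrm{chunk}:\{1,\dots,T\}\to\{1,\dots,K\}$ is defined by $\mathrm{chunk}(t)=k$ iff $t\in C_k$. Local transition matrices. $W^{(k)}$ is the $Q\times Q$ matrix with entries $$W^{(k)}_{lm}=\frac{\#\{t\in C_k: b_t=l,\ b_{t+1}=m,\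 t+1\in C_k\}}{\#\{t\in C_k: b_t=l,\ t+1\in C_k\}},\quad l,m\in\{1,\dots,Q\}.$$ All denominators are taken to be nonzero, so that every row of $W^{(k)}$ is defined and sums to $1$. Temporal Markov Transition Field. It is the $T\times T$ matrix $\mathcal{M}$ with $\mathcal{M}_{ij}=W^{(\mathrm{chunk}(i))}_{b_i,b_j}$ for $i,j\in\{1,\dots,T\}$. *)

theory Defs
  imports Complex_Main
begin

text \<open>A series of length \<open>T\<close> is a function \<open>x :: nat \<Rightarrow> real\<close> of which only the values at
  \<open>1, \<dots>, T\<close> matter; matrices are functions of two indices that start at \<open>1\<close>.\<close>

definition rank_structure :: "nat \<Rightarrow> (nat \<Rightarrow> real) \<Rightarrow> (nat \<times> nat) set" where
  "rank_structure T x = {(s, t). s \<in> {1..T} \<and> t \<in> {1..T} \<and> x s \<le> x t}"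

text \<open>The number \<open>a k\<close> is the adjustment of the \<open>k\<close>-th bin: its deviation from
  \<open>\<lfloor>T / Q\<rfloor>\<close> observations. Every observation has to lie in some bin, so that \<open>a\<close> cannot vanish
  unless \<open>Q\<close> divides \<open>T\<close>. The bins are half-open, so \<open>q Q\<close> exceeds the largest observation.\<close>

definition quantile_boundaries ::
    "nat \<Rightarrow> nat \<Rightarrow> (nat \<Rightarrow> int) \<Rightarrow> (nat \<Rightarrow> real) \<Rightarrow> (nat \<Rightarrow> real) \<Rightarrow> bool" where
  "quantile_boundaries T Q a x q \<longleftrightarrow>
     strict_mono_on {0..Q} q \<and>
     (\<forall>t\<in>{1..T}. q 0 \<le> x t \<and> x t < q Q) \<and>
     (\<forall>k\<in>{1..Q}. int (card {t \<in> {1..T}. q (k - 1) \<le> x t \<and> x t < q k}) = int (T div Q) + a k)"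

text \<open>A quantile rule selects boundaries \<open>bd x\<close> for every series \<open>x\<close> of length \<open>T\<close>. The bin
  sizes are adjusted according to a fixed prescription \<open>adj\<close>, which sees only the ordering of the
  observations, and only when bins of exactly \<open>\<lfloor>T / Q\<rfloor>\<close> observations are impossible (\<open>Q\<close> does not
  divide \<open>T\<close>, or tied observations would have to be separated). The positions of the
  boundaries themselves may depend on the values of \<open>x\<close>, as they do for interpolated quantiles.\<close>

definition quantile_rule :: "nat \<Rightarrow> nat \<Rightarrow> ((nat \<Rightarrow> real) \<Rightarrow> nat \<Rightarrow> real) \<Rightarrow> bool" where
  "quantile_rule T Q bd \<longleftrightarrow>
     (\<exists>adj :: (nat \<times> nat) set \<Rightarrow> nat \<Rightarrow> int.
        \<forall>x. quantile_boundaries T Q (adj (rank_structure T x)) x (bd x) \<and>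
            ((\<exists>q. quantile_boundaries T Q (\<lambda>_. 0) x q) \<longrightarrow>
               (\<forall>k\<in>{1..Q}. adj (rank_structure T x) k = 0)))"

definition state :: "((nat \<Rightarrow> real) \<Rightarrow> nat \<Rightarrow> real) \<Rightarrow> nat \<Rightarrow> (nat \<Rightarrow> real) \<Rightarrow> nat \<Rightarrow> nat" where
  "state bd Q x t = (THE k. k \<in> {1..Q} \<and> bd x (k - 1) \<le> x t \<and> x t < bd x k)"

text \<open>Used for \<open>K dvd T\<close> only, where \<open>T div K\<close> is the exact quotient.\<close>

definition temporal_chunk :: "nat \<Rightarrow> nat \<Rightarrow> nat \<Rightarrow> nat set" where
  "temporal_chunk T K k = {t. (k - 1) * (T div K) < t \<and> t \<le> k * (T div K)}"

definition chunk :: "nat \<Rightarrow> nat \<Rightarrow> nat \<Rightarrow> nat" where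
  "chunk T K t = (THE k. k \<in> {1..K} \<and> t \<in> temporal_chunk T K k)"

definition transition_count :: "nat set \<Rightarrow> (nat \<Rightarrow> nat) \<Rightarrow> nat \<Rightarrow> nat \<Rightarrow> nat" where
  "transition_count C b l m = card {t \<in> C. b t = l \<and> b (t + 1) = m \<and> t + 1 \<in> C}"

definition departure_count :: "nat set \<Rightarrow> (nat \<Rightarrow> nat) \<Rightarrow> nat \<Rightarrow> nat" where
  "departure_count C b l = card {t \<in> C. b t = l \<and> t + 1 \<in> C}"

definition local_transition_matrix ::
    "nat \<Rightarrow> nat \<Rightarrow> (nat \<Rightarrow> nat) \<Rightarrow> nat \<Rightarrow> nat \<Rightarrow> nat \<Rightarrow> real" where
  "local_transition_matrix T K b k l m =
     real (transition_count (temporal_chunk T K k) b l m) /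
     real (departure_count (temporal_chunk T K k) b l)"

definition denominators_nonzero :: "nat \<Rightarrow> nat \<Rightarrow> nat \<Rightarrow> (nat \<Rightarrow> nat) \<Rightarrow> bool" where
  "denominators_nonzero T Q K b \<longleftrightarrow>
     (\<forall>k\<in>{1..K}. \<forall>l\<in>{1..Q}. departure_count (temporal_chunk T K k) b l \<noteq> 0)"

definition tmtf ::
    "((nat \<Rightarrow> real) \<Rightarrow> nat \<Rightarrow> real) \<Rightarrow> nat \<Rightarrow> nat \<Rightarrow> nat \<Rightarrow> (nat \<Rightarrow> real) \<Rightarrow> nat \<Rightarrow> nat \<Rightarrow> real" where
  "tmtf bd T Q K x i j =
     local_transition_matrix T K (state bd Q x) (chunk T K i) (state bd Q x i) (state bd Q x j)"

end

theory Submission imports Defs begin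

text \<open>The observations below the \<open>k\<close>-th boundary form a lower set for the ordering of the
  observations, and their number is the sum of the first \<open>k\<close> bin sizes. Lower sets of a total
  preorder are nested, so each is determined by its cardinality. As \<open>f\<close> preserves the ordering,
  and hence the bin sizes, the lower sets of both series coincide, and so do the states.\<close>

definition below_boundary :: "nat \<Rightarrow> (nat \<Rightarrow> real) \<Rightarrow> real \<Rightarrow> nat set" where
  "below_boundary T x c = {t \<in> {1..T}. x t < c}"

lemma finite_below_boundary [simp]: "finite (below_boundary T x c)"
  by (simp add: below_boundary_def)

lemma card_below_boundary:
  assumes "quantile_boundaries T Q a x q" and "k \<le> Q"
  shows "int (card (below_boundary T x (q k))) = (\<Sum>j = 1..k. int (T div Q) + a j)"
  using assms(2)
proof (induction k)
  case 0
  have "below_boundary T x (q 0) = {}"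
    using assms(1) by (force simp: below_boundary_def quantile_boundaries_def)
  then show ?case by simp
next
  case (Suc k)
  let ?bin = "{t \<in> {1..T}. q k \<le> x t \<and> x t < q (Suc k)}"
  \<comment> \<open>Since the boundaries increase, passing to the next one loses no observation and
    adds exactly one bin.\<close>
  have "q k < q (Suc k)"
    using assms(1) Suc.prems by (auto simp: quantile_boundaries_def strict_mono_on_def)
  then have "below_boundary T x (q (Suc k)) = below_boundary T x (q k) \<union> ?bin"
    and "below_boundary T x (q k) \<inter> ?bin = {}"
    by (auto simp: below_boundary_def)
  then have "card (below_boundary T x (q (Suc k))) = card (below_boundary T x (q k)) + card ?bin"
    by (simp add: card_Un_disjoint)
  moreover have "int (card ?bin) = int (T div Q) + a (Suc k)"
    using assms(1) Suc.prems by (auto simp: quantile_boundaries_def dest: bspec[of _ _ "Suc k"])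
  ultimately show ?case using Suc by simp
qed

lemma below_boundary_eqI:
  assumes "rank_structure T x = rank_structure T y"
    and "card (below_boundary T x c) = card (below_boundary T y d)"
  shows "below_boundary T x c = below_boundary T y d"
proof -
  have ord: "x s \<le> x t \<longleftrightarrow> y s \<le> y t" if "s \<in> {1..T}" "t \<in> {1..T}" for s t
    using that assms(1) by (auto simp: rank_structure_def set_eq_iff)
  have "below_boundary T x c \<subseteq> below_boundary T y d \<or> below_boundary T y d \<subseteq> below_boundary T x c"
  proof (rule ccontr)
    assume "\<not> ?thesis"
    then obtain s t where "s \<in> {1..T}" "t \<in> {1..T}" "x s < c" "\<not> y s < d" "y t < d" "\<not> x t < c"
      by (auto simp: below_boundary_def)
    \<comment> \<open>Here x s < c \<le> x t while y t < d \<le> y s, so the two series order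
      \<open>s\<close> and \<open>t\<close> differently.\<close>
    then show False using ord[of t s] by linarith
  qed
  then show ?thesis
    using assms(2) by (metis card_subset_eq finite_below_boundary)
qed

lemma rank_structure_strict_mono:
  "strict_mono f \<Longrightarrow> rank_structure T (\<lambda>t. f (x t)) = rank_structure T x"
  by (simp add: rank_structure_def strict_mono_less_eq)

lemma state_eq_if_rank_structure_eq:
  assumes "quantile_rule T Q bd" and "rank_structure T x = rank_structure T y"
    and "t \<in> {1..T}"
  shows "state bd Q x t = state bd Q y t"
proof -
  \<comment> \<open>One \<open>a\<close> serves both series because \<open>adj\<close> sees only the
    rank structure. The boundaries \<open>bd x\<close> and \<open>bd y\<close> are not otherwise
    related.\<close>
  obtain a where a: "quantile_boundaries T Q a x (bd x)" "quantile_boundaries T Q a y (bd y)"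
    using assms(1,2) unfolding quantile_rule_def by metis
  have eq: "x t < bd x k \<longleftrightarrow> y t < bd y k" if "k \<le> Q" for k
  proof -
    have "card (below_boundary T x (bd x k)) = card (below_boundary T y (bd y k))"
      using card_below_boundary[OF a(1) that] card_below_boundary[OF a(2) that] by linarith
    from below_boundary_eqI[OF assms(2) this] show ?thesis
      using assms(3) by (auto simp: below_boundary_def set_eq_iff)
  qed
  \<comment> \<open>A bin is the difference of two consecutive lower sets, so \<open>eq\<close> at
    \<open>k\<close> and \<open>k - 1\<close> decides membership. The two \<open>THE\<close> terms
    then range over the same predicate.\<close>
  have "(k \<in> {1..Q} \<and> bd x (k - 1) \<le> x t \<and> x t < bd x k) \<longleftrightarrow>
        (k \<in> {1..Q} \<and> bd y (k - 1) \<le> y t \<and> y t < bd y k)" for k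
    using eq[of k] eq[of "k - 1"] by (cases "k \<le> Q") (simp_all add: not_less[symmetric])
  then show ?thesis by (simp add: state_def)
qed

lemma temporal_chunk_subset:
  assumes "k \<in> {1..K}"
  shows "temporal_chunk T K k \<subseteq> {1..T}"
proof -
  have "k * (T div K) \<le> K * (T div K)"
    using assms by simp
  also have "\<dots> \<le> T"
    by simp
  finally have "k * (T div K) \<le> T" .
  then show ?thesis by (auto simp: temporal_chunk_def)
qed

text \<open>As \<open>chunk\<close> is a definite description, its range is known only once
  existence and uniqueness are shown. Divisibility makes the K blocks of length \<open>d\<close>
  cover all of 1, ..., T.\<close>

lemma chunk_in_range:
  assumes "K dvd T" and "i \<in> {1..T}"
  shows "chunk T K i \<in> {1..K}"
proof -
  define d where "d = T div K"
  have T: "T = K * d" using assms(1) by (simp add: d_def)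
  then have d: "d > 0" using assms(2) by (cases d) auto
  \<comment> \<open>Chunks are open on the left and closed on the right, so a multiple of
    \<open>d\<close> ends its chunk; hence the shift by one before dividing.\<close>
  define k where "k = (i - 1) div d + 1"
  have "i - 1 < K * d" using assms(2) T by auto
  then have "(i - 1) div d < K" using d by (simp add: div_less_iff_less_mult)
  then have kK: "k \<in> {1..K}" by (simp add: k_def)
  have "i - 1 < k * d" "(k - 1) * d \<le> i - 1"
    using dividend_less_div_times[OF d, of "i - 1"] by (simp_all add: k_def)
  then have mem: "i \<in> temporal_chunk T K k"
    using assms(2) by (auto simp: temporal_chunk_def d_def)
  \<comment> \<open>The time \<open>i\<close> lies above the left end of chunk \<open>m\<close> and
    not beyond the right end of chunk \<open>n\<close>. Exchanging the roles gives uniqueness by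
    antisymmetry.\<close>
  have uniq: "m \<le> n" if "i \<in> temporal_chunk T K m" "i \<in> temporal_chunk T K n"
    for m n
  proof -
    have "(m - 1) * d < n * d"
      using that unfolding temporal_chunk_def d_def mem_Collect_eq
      by (elim conjE) (rule less_le_trans)
    then have "m - 1 < n" by simp
    then show ?thesis by simp
  qed
  have "\<exists>!k. k \<in> {1..K} \<and> i \<in> temporal_chunk T K k"
    using kK mem uniq by (meson antisym)
  from theI'[OF this] show ?thesis by (simp add: chunk_def)
qed

text \<open>Agreement up to \<open>T\<close> suffices although the counts look at
  \<open>b (t + 1)\<close>: the condition that \<open>t + 1\<close> stays in the chunk keeps that
  time at most \<open>T\<close>.\<close>

lemma local_transition_matrix_cong:
  assumes "k \<in> {1..K}" and "\<And>t. t \<in> {1..T} \<Longrightarrow> b t = c t"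
  shows "local_transition_matrix T K b k l m = local_transition_matrix T K c k l m"
proof -
  have "b t = c t" if "t \<in> temporal_chunk T K k" for t
    using that temporal_chunk_subset[OF assms(1)] assms(2) by blast
  then have "transition_count (temporal_chunk T K k) b = transition_count (temporal_chunk T K k) c"
    and "departure_count (temporal_chunk T K k) b = departure_count (temporal_chunk T K k) c"
    unfolding transition_count_def departure_count_def fun_eq_iff
    by (auto intro!: arg_cong[where f = card])
  then show ?thesis by (simp add: local_transition_matrix_def)
qed

theorem proposition4p3:
  fixes x :: "nat \<Rightarrow> real" and f :: "real \<Rightarrow> real" and T Q K :: nat
    and bd :: "(nat \<Rightarrow> real) \<Rightarrow> nat \<Rightarrow> real"
  assumes "T \<ge> 1" and "Q \<ge> 1" and "K \<ge> 1" and "K dvd T"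
    and "quantile_rule T Q bd"
    and "denominators_nonzero T Q K (state bd Q x)"
    and "strict_mono f"
  shows "\<forall>i\<in>{1..T}. \<forall>j\<in>{1..T}. tmtf bd T Q K (\<lambda>t. f (x t)) i j = tmtf bd T Q K x i j"
proof (intro ballI)
  fix i j assume ij: "i \<in> {1..T}" "j \<in> {1..T}"
  have state: "state bd Q (\<lambda>t. f (x t)) t = state bd Q x t" if "t \<in> {1..T}" for t
    using state_eq_if_rank_structure_eq[OF assms(5) rank_structure_strict_mono[OF assms(7)] that] .
  show "tmtf bd T Q K (\<lambda>t. f (x t)) i j = tmtf bd T Q K x i j"
    \<comment> \<open>The chunk index does not depend on the series. After the row and column states
      are rewritten, the sides differ only in the state sequence passed to the local matrix, known
      to agree on 1, ..., T only.\<close>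
    unfolding tmtf_def state[OF ij(1)] state[OF ij(2)]
    by (rule local_transition_matrix_cong[OF chunk_in_range[OF assms(4) ij(1)] state])
qed

end
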